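(* If $Q$ is a loop, then $Z(Q) = N_{\zeta(Q)}$.
   Context: A loop is an algebra $(Q,1,\cdot,\backslash,/)$ satisfying $x\cdot 1=x=1\cdot x$, $x\backslash(x\cdot y)=y$, $x\cdot(x\backslash y)=y$, $(y\cdot x)/x=y$, $(y/x)\cdot x=y$. The (loop-theoretic) center is $$Z(Q)=\{a\in Q : ax=xa,\ a(xy)=(ax)y,\ x(ay)=(xa)y,\ x(ya)=(xy)a\text{ for every }x,y\in Q\}.$$ For a congruence $\alpha$ of $Q$, $N_\alpha=\{a\in Q : a\,\alpha\,1\}$. For congruences $\alpha,\beta,\delta$ of an algebra $\mathbf A$, $C(\alpha,\beta;\delta)$ means that for every $(n+1)$-ary term operation $t$, every $a\,\alpha\,b$ and every $u_1\,\beta\,v_1,\dots,u_n\,\beta\,v_n$, $t(a,u_1,\dots,u_n)\,\delta\,t(a,v_1,\dots,v_n)$ implies $t(b,u_1,\dots,u_n)\,\delta\,t(b,v_1,\dots,v_n)$. With $1_{\mathbf A}=\mathbf A\times\mathbf A$ and $0_{\mathbf A}=\{(a,a) : a\in\mathbf A\}$, the (universal algebraic) center $\zeta(\mathbf A)$ is the largest congruence of $\mathbf A$ such that $C(\zeta(\mathbf A),1_{\mathbf A};0_{\mathbf A})$. *)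

theory Defs
  imports "HOL-Algebra.Group"
begin

record ('a, 'f) algebra = "'a partial_object" +
  arity :: "'f \<Rightarrow> nat"
  oper :: "'f \<Rightarrow> 'a list \<Rightarrow> 'a"

datatype 'f tm = Var nat | App 'f "'f tm list"

text \<open>A term is in variables \<open>x\<^sub>0, \<dots>, x\<^sub>k\<^sub>-\<^sub>1\<close>; it need not use all of them.\<close>

fun tm_in :: "('f \<Rightarrow> nat) \<Rightarrow> nat \<Rightarrow> 'f tm \<Rightarrow> bool" where
  "tm_in ar k (Var i) \<longleftrightarrow> i < k"
| "tm_in ar k (App f ts) \<longleftrightarrow> length ts = ar f \<and> (\<forall>t\<in>set ts. tm_in ar k t)"

fun tm_op :: "('a, 'f, 'm) algebra_scheme \<Rightarrow> 'f tm \<Rightarrow> 'a list \<Rightarrow> 'a" where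
  "tm_op A (Var i) xs = xs ! i"
| "tm_op A (App f ts) xs = oper A f (map (\<lambda>t. tm_op A t xs) ts)"

definition congruence :: "('a, 'f, 'm) algebra_scheme \<Rightarrow> ('a \<times> 'a) set \<Rightarrow> bool" where
  "congruence A \<alpha> \<longleftrightarrow> equiv (carrier A) \<alpha> \<and>
    (\<forall>f xs ys. length xs = arity A f \<and> list_all2 (\<lambda>x y. (x, y) \<in> \<alpha>) xs ys
      \<longrightarrow> (oper A f xs, oper A f ys) \<in> \<alpha>)"

definition centralizes ::
  "('a, 'f, 'm) algebra_scheme \<Rightarrow> ('a \<times> 'a) set \<Rightarrow> ('a \<times> 'a) set \<Rightarrow> ('a \<times> 'a) set \<Rightarrow> bool" where
  "centralizes A \<alpha> \<beta> \<delta> \<longleftrightarrow>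
    (\<forall>n t a b us vs.
      tm_in (arity A) (n + 1) t \<and> (a, b) \<in> \<alpha> \<and>
      length us = n \<and> length vs = n \<and> list_all2 (\<lambda>u v. (u, v) \<in> \<beta>) us vs \<and>
      (tm_op A t (a # us), tm_op A t (a # vs)) \<in> \<delta>
      \<longrightarrow> (tm_op A t (b # us), tm_op A t (b # vs)) \<in> \<delta>)"

definition full_cong :: "('a, 'f, 'm) algebra_scheme \<Rightarrow> ('a \<times> 'a) set" where
  "full_cong A = carrier A \<times> carrier A"

definition zero_cong :: "('a, 'f, 'm) algebra_scheme \<Rightarrow> ('a \<times> 'a) set" where
  "zero_cong A = Id_on (carrier A)"

definition ua_center :: "('a, 'f, 'm) algebra_scheme \<Rightarrow> ('a \<times> 'a) set" where
  "ua_center A =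
    (GREATEST \<alpha>. congruence A \<alpha> \<and> centralizes A \<alpha> (full_cong A) (zero_cong A))"

text \<open>\<open>ldiv Q x y\<close> is the left division $x \backslash y$ and \<open>rdiv Q x y\<close> is the right
  division $x / y$.\<close>

record 'a loop = "'a monoid" +
  ldiv :: "'a \<Rightarrow> 'a \<Rightarrow> 'a" (infixl "\<setminus>\<index>" 70)
  rdiv :: "'a \<Rightarrow> 'a \<Rightarrow> 'a" (infixl "\<oslash>\<index>" 70)

locale loop =
  fixes Q (structure)
  assumes one_closed: "\<one> \<in> carrier Q"
    and mult_closed: "\<lbrakk>x \<in> carrier Q; y \<in> carrier Q\<rbrakk> \<Longrightarrow> x \<otimes> y \<in> carrier Q"
    and ldiv_closed: "\<lbrakk>x \<in> carrier Q; y \<in> carrier Q\<rbrakk> \<Longrightarrow> x \<setminus> y \<in> carrier Q"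
    and rdiv_closed: "\<lbrakk>x \<in> carrier Q; y \<in> carrier Q\<rbrakk> \<Longrightarrow> x \<oslash> y \<in> carrier Q"
    and mult_one: "x \<in> carrier Q \<Longrightarrow> x \<otimes> \<one> = x"
    and one_mult: "x \<in> carrier Q \<Longrightarrow> \<one> \<otimes> x = x"
    and ldiv_mult: "\<lbrakk>x \<in> carrier Q; y \<in> carrier Q\<rbrakk> \<Longrightarrow> x \<setminus> (x \<otimes> y) = y"
    and mult_ldiv: "\<lbrakk>x \<in> carrier Q; y \<in> carrier Q\<rbrakk> \<Longrightarrow> x \<otimes> (x \<setminus> y) = y"
    and mult_rdiv: "\<lbrakk>x \<in> carrier Q; y \<in> carrier Q\<rbrakk> \<Longrightarrow> (y \<otimes> x) \<oslash> x = y"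
    and rdiv_mult: "\<lbrakk>x \<in> carrier Q; y \<in> carrier Q\<rbrakk> \<Longrightarrow> (y \<oslash> x) \<otimes> x = y"

datatype loop_sym = One | Mult | LDiv | RDiv

fun loop_arity :: "loop_sym \<Rightarrow> nat" where
  "loop_arity One = 0"
| "loop_arity Mult = 2"
| "loop_arity LDiv = 2"
| "loop_arity RDiv = 2"

fun loop_oper :: "('a, 'm) loop_scheme \<Rightarrow> loop_sym \<Rightarrow> 'a list \<Rightarrow> 'a" where
  "loop_oper Q One xs = \<one>\<^bsub>Q\<^esub>"
| "loop_oper Q Mult xs = xs ! 0 \<otimes>\<^bsub>Q\<^esub> xs ! 1"
| "loop_oper Q LDiv xs = xs ! 0 \<setminus>\<^bsub>Q\<^esub> xs ! 1"
| "loop_oper Q RDiv xs = xs ! 0 \<oslash>\<^bsub>Q\<^esub> xs ! 1"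

definition loop_algebra :: "('a, 'm) loop_scheme \<Rightarrow> ('a, loop_sym) algebra" where
  "loop_algebra Q = \<lparr>carrier = carrier Q, arity = loop_arity, oper = loop_oper Q\<rparr>"

definition loop_center :: "('a, 'm) loop_scheme \<Rightarrow> 'a set" where
  "loop_center Q = {a \<in> carrier Q. \<forall>x\<in>carrier Q. \<forall>y\<in>carrier Q.
     a \<otimes>\<^bsub>Q\<^esub> x = x \<otimes>\<^bsub>Q\<^esub> a \<and>
     a \<otimes>\<^bsub>Q\<^esub> (x \<otimes>\<^bsub>Q\<^esub> y) = (a \<otimes>\<^bsub>Q\<^esub> x) \<otimes>\<^bsub>Q\<^esub> y \<and>
     x \<otimes>\<^bsub>Q\<^esub> (a \<otimes>\<^bsub>Q\<^esub> y) = (x \<otimes>\<^bsub>Q\<^esub> a) \<otimes>\<^bsub>Q\<^esub> y \<and>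
     x \<otimes>\<^bsub>Q\<^esub> (y \<otimes>\<^bsub>Q\<^esub> a) = (x \<otimes>\<^bsub>Q\<^esub> y) \<otimes>\<^bsub>Q\<^esub> a}"

definition cong_kernel :: "('a, 'm) loop_scheme \<Rightarrow> ('a \<times> 'a) set \<Rightarrow> 'a set" where
  "cong_kernel Q \<alpha> = {a \<in> carrier Q. (a, \<one>\<^bsub>Q\<^esub>) \<in> \<alpha>}"

end

theory Submission imports Defs begin

text \<open>
  Two elements are identified by \<open>\<zeta>(Q)\<close> iff they differ by a left factor from \<open>Z(Q)\<close>.
  Central factors can be pulled out of every loop operation, hence out of every term: \<open>t(z a, u) = w t(a, u)\<close> with
  \<open>w \<in> Z(Q)\<close> depending only on \<open>z\<close> and \<open>t\<close>; so this relation is a congruence that centralizes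
  \<open>1\<^sub>Q\<close>. Conversely, if \<open>\<alpha>\<close> centralizes \<open>1\<^sub>Q\<close> and \<open>a \<alpha> 1\<close>, the identities that define \<open>Z(Q)\<close>
  hold for \<open>a\<close> because each has the form \<open>t(a, u) = t(a, v)\<close> with \<open>t(1, u) = t(1, v)\<close>
  trivially true.
\<close>

section \<open>Centers and the term condition in arbitrary algebras\<close>

lemma ua_center_eqI:
  assumes "congruence A \<alpha>" "centralizes A \<alpha> (full_cong A) (zero_cong A)"
    and "\<And>\<beta>. \<lbrakk>congruence A \<beta>; centralizes A \<beta> (full_cong A) (zero_cong A)\<rbrakk> \<Longrightarrow> \<beta> \<subseteq> \<alpha>"
  shows "ua_center A = \<alpha>"
  \<comment> \<open>\<open>GREATEST\<close> here refers to the inclusion order on relations, so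
    exhibiting one centralizing congruence that contains all the others settles its value.\<close>
  unfolding ua_center_def using assms by (intro Greatest_equality) auto

lemma congruence_refl: "\<lbrakk>congruence A \<alpha>; x \<in> carrier A\<rbrakk> \<Longrightarrow> (x, x) \<in> \<alpha>"
  unfolding congruence_def equiv_def refl_on_def by blast

text \<open>Since \<open>zero_cong A\<close> is the identity on the carrier only, the common value
  at \<open>a\<close> has to lie there; an arbitrary \<open>algebra\<close> does not guarantee that
  its terms are closed.\<close>

lemma centralizes_fullD:
  assumes "centralizes A \<alpha> (full_cong A) (zero_cong A)" "(a, b) \<in> \<alpha>"
    and "tm_in (arity A) (Suc (length us)) t" "length us = length vs"
    and "set us \<subseteq> carrier A" "set vs \<subseteq> carrier A"
    and "tm_op A t (a # us) = tm_op A t (a # vs)" "tm_op A t (a # vs) \<in> carrier A"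
  shows "tm_op A t (b # us) = tm_op A t (b # vs)"
proof -
  have "list_all2 (\<lambda>u v. (u, v) \<in> full_cong A) us vs"
    using assms(4-6) unfolding list_all2_conv_all_nth full_cong_def
    by (auto simp: subset_iff)
  then have "(tm_op A t (b # us), tm_op A t (b # vs)) \<in> zero_cong A"
    using assms unfolding centralizes_def zero_cong_def
    by (metis Id_onI Suc_eq_plus1)
  then show ?thesis by (auto simp: zero_cong_def)
qed

lemma list_length_2E:
  assumes "length xs = 2"
  obtains x y where "xs = [x, y]"
  using assms by (auto simp: numeral_2_eq_2 length_Suc_conv)

definition center_rel :: "('a, 'm) loop_scheme \<Rightarrow> ('a \<times> 'a) set" where
  "center_rel Q = {(z \<otimes>\<^bsub>Q\<^esub> b, b) | z b. z \<in> loop_center Q \<and> b \<in> carrier Q}"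

lemma loop_algebra_simps [simp]:
  "carrier (loop_algebra Q) = carrier Q"
  "arity (loop_algebra Q) = loop_arity"
  "oper (loop_algebra Q) = loop_oper Q"
  by (simp_all add: loop_algebra_def)

context loop
begin

section \<open>The center of a loop is closed under the loop operations\<close>

abbreviation "Z \<equiv> loop_center Q"

lemmas closed = one_closed mult_closed ldiv_closed rdiv_closed

lemma center_closed: "z \<in> Z \<Longrightarrow> z \<in> carrier Q"
  by (simp add: loop_center_def)

lemma center_comm: "\<lbrakk>z \<in> Z; x \<in> carrier Q\<rbrakk> \<Longrightarrow> z \<otimes> x = x \<otimes> z"
  using one_closed by (auto simp: loop_center_def)

lemma center_assoc1:
  "\<lbrakk>z \<in> Z; x \<in> carrier Q; y \<in> carrier Q\<rbrakk> \<Longrightarrow> z \<otimes> (x \<otimes> y) = (z \<otimes> x) \<otimes> y"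
  by (simp add: loop_center_def)

lemma center_assoc2:
  "\<lbrakk>z \<in> Z; x \<in> carrier Q; y \<in> carrier Q\<rbrakk> \<Longrightarrow> x \<otimes> (z \<otimes> y) = (x \<otimes> z) \<otimes> y"
  unfolding loop_center_def by blast

lemma center_left_comm:
  "\<lbrakk>z \<in> Z; x \<in> carrier Q; y \<in> carrier Q\<rbrakk> \<Longrightarrow> x \<otimes> (z \<otimes> y) = z \<otimes> (x \<otimes> y)"
  by (metis center_assoc1 center_assoc2 center_comm)

text \<open>The fourth identity follows from the other three: x(ya) = x(ay) = (xa)y = (ax)y = a(xy)
  = (xy)a.\<close>

lemma centerI:
  assumes "a \<in> carrier Q"
    and c: "\<And>x. x \<in> carrier Q \<Longrightarrow> a \<otimes> x = x \<otimes> a"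
    and l: "\<And>x y. \<lbrakk>x \<in> carrier Q; y \<in> carrier Q\<rbrakk> \<Longrightarrow> a \<otimes> (x \<otimes> y) = (a \<otimes> x) \<otimes> y"
    and m: "\<And>x y. \<lbrakk>x \<in> carrier Q; y \<in> carrier Q\<rbrakk> \<Longrightarrow> x \<otimes> (a \<otimes> y) = (x \<otimes> a) \<otimes> y"
  shows "a \<in> Z"
proof -
  have "x \<otimes> (y \<otimes> a) = (x \<otimes> y) \<otimes> a" if "x \<in> carrier Q" "y \<in> carrier Q" for x y
    using that by (metis c l m mult_closed)
  then show ?thesis using assms unfolding loop_center_def by blast
qed

lemma left_cancel:
  "\<lbrakk>a \<otimes> x = a \<otimes> y; a \<in> carrier Q; x \<in> carrier Q; y \<in> carrier Q\<rbrakk> \<Longrightarrow> x = y"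
  by (metis ldiv_mult)

lemma ldiv_eqI:
  "\<lbrakk>x \<otimes> r = y; x \<in> carrier Q; r \<in> carrier Q\<rbrakk> \<Longrightarrow> x \<setminus> y = r"
  using ldiv_mult by blast

lemma rdiv_eqI:
  "\<lbrakk>r \<otimes> x = y; x \<in> carrier Q; r \<in> carrier Q\<rbrakk> \<Longrightarrow> y \<oslash> x = r"
  using mult_rdiv by blast

lemma center_one: "\<one> \<in> Z"
  by (rule centerI) (simp_all add: one_closed mult_closed one_mult mult_one)

lemma center_mult:
  assumes z: "z \<in> Z" and w: "w \<in> Z"
  shows "z \<otimes> w \<in> Z"
proof (rule centerI)
  note zc = center_closed[OF z] and wc = center_closed[OF w]
  show "z \<otimes> w \<in> carrier Q" by (simp add: zc wc mult_closed)
  fix x assume x: "x \<in> carrier Q"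
  show c: "(z \<otimes> w) \<otimes> x = x \<otimes> (z \<otimes> w)"
    using x zc wc
    by (metis center_assoc1 center_comm center_left_comm mult_closed w z)
  fix y assume y: "y \<in> carrier Q"
  note assoc = center_assoc1[OF z, symmetric] center_assoc1[OF w, symmetric]
  show l: "(z \<otimes> w) \<otimes> (x \<otimes> y) = ((z \<otimes> w) \<otimes> x) \<otimes> y"
    using x y wc by (simp add: assoc mult_closed)
  \<comment> \<open>Neither associativity nor commutativity of \<open>z \<otimes> w\<close> in the
    middle is known yet, so z and w are moved past x one at a time.\<close>
  have "x \<otimes> ((z \<otimes> w) \<otimes> y) = (z \<otimes> w) \<otimes> (x \<otimes> y)"
    using x y wc
    by (simp add: assoc mult_closed center_left_comm[OF z x] center_left_comm[OF w x])
  also have "\<dots> = (x \<otimes> (z \<otimes> w)) \<otimes> y" by (simp only: l c)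
  finally show "x \<otimes> ((z \<otimes> w) \<otimes> y) = (x \<otimes> (z \<otimes> w)) \<otimes> y" .
qed

text \<open>Left multiplication by z turns each identity for v into one for the central element zv;
  cancelling z gives it back for v. Both divisions of central elements reduce to this, because their
  quotient times the divisor is central.\<close>

lemma center_left_factor:
  assumes z: "z \<in> Z" and v: "v \<in> carrier Q" and w: "z \<otimes> v \<in> Z"
  shows "v \<in> Z"
proof (rule centerI)
  note zc = center_closed[OF z]
  have pull: "z \<otimes> (v \<otimes> u) = (z \<otimes> v) \<otimes> u" if "u \<in> carrier Q" for u
    using center_assoc1[OF z v that] .
  show "v \<in> carrier Q" by (rule v)
  fix x assume x: "x \<in> carrier Q"
  show c: "v \<otimes> x = x \<otimes> v"
    by (rule left_cancel[of z])
      (simp_all add: pull x v zc mult_closed center_comm[OF w x] flip: center_left_comm[OF z x v])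
  fix y assume y: "y \<in> carrier Q"
  show l: "v \<otimes> (x \<otimes> y) = (v \<otimes> x) \<otimes> y"
    by (rule left_cancel[of z])
      (simp_all add: pull x y v zc mult_closed center_assoc1[OF w] center_assoc1[OF z])
  have "z \<otimes> (x \<otimes> (v \<otimes> y)) = z \<otimes> (v \<otimes> (x \<otimes> y))"
    using x y v
    by (simp add: pull mult_closed center_left_comm[OF w x] flip: center_left_comm[OF z x])
  then have "x \<otimes> (v \<otimes> y) = v \<otimes> (x \<otimes> y)"
    by (rule left_cancel) (simp_all add: x y v zc mult_closed)
  then show "x \<otimes> (v \<otimes> y) = (x \<otimes> v) \<otimes> y"
    by (simp add: l c x)
qed

lemma center_ldiv: "\<lbrakk>z \<in> Z; w \<in> Z\<rbrakk> \<Longrightarrow> z \<setminus> w \<in> Z"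
  by (rule center_left_factor[of z]) (simp_all add: center_closed ldiv_closed mult_ldiv)

lemma center_rdiv: "\<lbrakk>z \<in> Z; w \<in> Z\<rbrakk> \<Longrightarrow> w \<oslash> z \<in> Z"
  by (rule center_left_factor[of z])
    (simp_all add: center_closed rdiv_closed rdiv_mult center_comm[of z "w \<oslash> z"])

section \<open>Pulling central factors out of a single operation\<close>

lemma center_mult_mult:
  assumes z: "z \<in> Z" and w: "w \<in> Z" and p: "p \<in> carrier Q" and q: "q \<in> carrier Q"
  shows "(z \<otimes> p) \<otimes> (w \<otimes> q) = (z \<otimes> w) \<otimes> (p \<otimes> q)"
proof -
  have "(z \<otimes> p) \<otimes> (w \<otimes> q) = z \<otimes> (w \<otimes> (p \<otimes> q))"
    using assms by (simp add: center_closed mult_closed center_left_comm[OF w p q]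
      flip: center_assoc1[OF z])
  then show ?thesis using assms by (simp add: center_closed mult_closed center_assoc1[OF z])
qed

text \<open>The right-hand side solves the equation that determines the left division: by
  \<open>center_mult_mult\<close>, multiplying it on the left by zp gives
  (z(z\<setminus>w))(p(p\<setminus>q)) = wq. The right division is dual.\<close>

lemma center_mult_ldiv:
  assumes "z \<in> Z" "w \<in> Z" "p \<in> carrier Q" "q \<in> carrier Q"
  shows "(z \<otimes> p) \<setminus> (w \<otimes> q) = (z \<setminus> w) \<otimes> (p \<setminus> q)"
  using assms center_mult_mult[of z "z \<setminus> w" p "p \<setminus> q"]
  by (intro ldiv_eqI) (simp_all add: center_ldiv center_closed closed mult_ldiv)

lemma center_mult_rdiv:
  assumes "z \<in> Z" "w \<in> Z" "p \<in> carrier Q" "q \<in> carrier Q"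
  shows "(w \<otimes> q) \<oslash> (z \<otimes> p) = (w \<oslash> z) \<otimes> (q \<oslash> p)"
  using assms center_mult_mult[of "w \<oslash> z" z "q \<oslash> p" p]
  by (intro rdiv_eqI) (simp_all add: center_rdiv center_closed closed rdiv_mult)

section \<open>Pulling central factors out of terms\<close>

lemma tm_op_closed:
  "\<lbrakk>tm_in loop_arity k t; set xs \<subseteq> carrier Q; k \<le> length xs\<rbrakk>
    \<Longrightarrow> tm_op (loop_algebra Q) t xs \<in> carrier Q"
proof (induction t)
  case (Var i)
  then show ?case by (auto simp: subset_iff)
next
  case (App f ts)
  then show ?case by (cases f) (auto simp: closed elim!: list_length_2E)
qed

text \<open>The factor does not depend on \<open>x\<close> and \<open>xs\<close>: this uniformity is what the centralizer
  condition needs.\<close>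

lemma tm_op_center_mult:
  assumes z: "z \<in> Z"
  shows "tm_in loop_arity (Suc k) t \<Longrightarrow>
    \<exists>w\<in>Z. \<forall>x xs. x \<in> carrier Q \<longrightarrow> set xs \<subseteq> carrier Q \<longrightarrow> length xs = k \<longrightarrow>
      tm_op (loop_algebra Q) t (z \<otimes> x # xs) = w \<otimes> tm_op (loop_algebra Q) t (x # xs)"
proof (induction t)
  case (Var i)
  show ?case
  proof (cases i)
    case 0
    then show ?thesis using z by auto
  next
    \<comment> \<open>A variable other than the first does not see z, so its factor is 1.\<close>
    case (Suc j)
    then show ?thesis
      using Var center_one by (intro bexI[of _ \<one>]) (auto simp: one_mult subset_iff)
  qed
next
  case (App f ts)
  show ?case
  proof (cases "f = One")
    case True
    then show ?thesis using center_one by (intro bexI[of _ \<one>]) (auto simp: one_mult one_closed)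
  next
    case False
    then have "length ts = 2" using App.prems by (cases f) auto
    then obtain s t where ts: "ts = [s, t]" by (rule list_length_2E)
    from App.prems ts have st: "tm_in loop_arity (Suc k) s" "tm_in loop_arity (Suc k) t" by auto
    have cl: "tm_op (loop_algebra Q) r (x # xs) \<in> carrier Q"
      if "tm_in loop_arity (Suc k) r" "x \<in> carrier Q" "set xs \<subseteq> carrier Q" "length xs = k"
      for r x xs
      using that by (intro tm_op_closed) auto
    obtain v where v: "v \<in> Z" "\<And>x xs. \<lbrakk>x \<in> carrier Q; set xs \<subseteq> carrier Q; length xs = k\<rbrakk> \<Longrightarrow>
      tm_op (loop_algebra Q) s (z \<otimes> x # xs) = v \<otimes> tm_op (loop_algebra Q) s (x # xs)"
      using App.IH[of s] st ts by auto
    obtain w where w: "w \<in> Z" "\<And>x xs. \<lbrakk>x \<in> carrier Q; set xs \<subseteq> carrier Q; length xs = k\<rbrakk> \<Longrightarrow>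
      tm_op (loop_algebra Q) t (z \<otimes> x # xs) = w \<otimes> tm_op (loop_algebra Q) t (x # xs)"
      using App.IH[of t] st ts by auto
    \<comment> \<open>The factor of a compound term is the outer operation applied to the factors of
      its two subterms.\<close>
    have u: "loop_oper Q f [v, w] \<in> Z"
      using v w False by (cases f) (auto simp: center_mult center_ldiv center_rdiv)
    have "tm_op (loop_algebra Q) (App f ts) (z \<otimes> x # xs) =
        loop_oper Q f [v, w] \<otimes> tm_op (loop_algebra Q) (App f ts) (x # xs)"
      if x: "x \<in> carrier Q" "set xs \<subseteq> carrier Q" "length xs = k" for x xs
    proof -
      note cl = cl[OF st(1) x] cl[OF st(2) x]
      show ?thesis
        using False ts center_mult_mult[OF v(1) w(1) cl] center_mult_ldiv[OF v(1) w(1) cl]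
          center_mult_rdiv[OF w(1) v(1) cl(2) cl(1)]
        by (cases f) (simp_all add: v(2)[OF x] w(2)[OF x])
    qed
    with u show ?thesis by blast
  qed
qed

section \<open>\<open>center_rel\<close> is a centralizing congruence\<close>

lemma center_rel_sym: "sym (center_rel Q)"
proof (rule symI)
  fix a b assume "(a, b) \<in> center_rel Q"
  then obtain z where z: "z \<in> Z" "b \<in> carrier Q" "a = z \<otimes> b" by (auto simp: center_rel_def)
  have "z \<setminus> \<one> \<in> Z" using z by (simp add: center_ldiv center_one)
  moreover have "(z \<setminus> \<one>) \<otimes> a = b"
    \<comment> \<open>With p = 1 the exchange law reads (z\<setminus>1)(zb) = ((z\<setminus>1)z)b,
      and (z\<setminus>1)z = z(z\<setminus>1) = 1 because z is central.\<close>
    using center_mult_mult[OF calculation z(1) one_closed z(2)] z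
    by (simp add: center_closed closed mult_ldiv one_mult mult_one
        center_comm[OF calculation center_closed[OF z(1)]])
  moreover have "a \<in> carrier Q" using z by (simp add: center_closed mult_closed)
  ultimately show "(b, a) \<in> center_rel Q" unfolding center_rel_def by blast
qed

lemma equiv_center_rel: "equiv (carrier Q) (center_rel Q)"
proof (rule equivI)
  show "center_rel Q \<subseteq> carrier Q \<times> carrier Q"
    by (auto simp: center_rel_def center_closed mult_closed)
  show "refl_on (carrier Q) (center_rel Q)"
    using center_one one_mult unfolding center_rel_def by (force intro!: refl_onI)
  show "sym (center_rel Q)" by (rule center_rel_sym)
  show "trans (center_rel Q)"
  proof (rule transI)
    fix a b c assume "(a, b) \<in> center_rel Q" "(b, c) \<in> center_rel Q"
    then obtain z w where "z \<in> Z" "w \<in> Z" "a = z \<otimes> b" "b = w \<otimes> c" "c \<in> carrier Q"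
      by (auto simp: center_rel_def)
    then have "a = (z \<otimes> w) \<otimes> c" "z \<otimes> w \<in> Z"
      by (simp_all add: center_assoc1 center_closed center_mult)
    with \<open>c \<in> carrier Q\<close> show "(a, c) \<in> center_rel Q" unfolding center_rel_def by blast
  qed
qed

lemma congruence_center_rel: "congruence (loop_algebra Q) (center_rel Q)"
  unfolding congruence_def
proof (intro conjI allI impI; (elim conjE)?)
  show "equiv (carrier (loop_algebra Q)) (center_rel Q)" by (simp add: equiv_center_rel)
  fix f xs ys
  assume len: "length xs = arity (loop_algebra Q) f"
    and rel: "list_all2 (\<lambda>x y. (x, y) \<in> center_rel Q) xs ys"
  show "(oper (loop_algebra Q) f xs, oper (loop_algebra Q) f ys) \<in> center_rel Q"
  proof (cases "f = One")
    case True
    have "(\<one>, \<one>) \<in> center_rel Q"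
      using equiv_center_rel one_closed by (auto simp: equiv_def refl_on_def)
    with True show ?thesis by simp
  next
    case False
    then have "length xs = 2" using len by (cases f) auto
    then obtain x1 x2 where xs: "xs = [x1, x2]" by (rule list_length_2E)
    then obtain y1 y2 where ys: "ys = [y1, y2]"
      and "(x1, y1) \<in> center_rel Q" "(x2, y2) \<in> center_rel Q"
      using rel by (auto simp: list_all2_Cons1)
    then obtain z w where zw: "z \<in> Z" "x1 = z \<otimes> y1" "w \<in> Z" "x2 = w \<otimes> y2"
      and y: "y1 \<in> carrier Q" "y2 \<in> carrier Q"
      by (auto simp: center_rel_def)
    have "loop_oper Q f xs = loop_oper Q f [z, w] \<otimes> loop_oper Q f ys"
      using False zw y xs ys
      by (cases f) (simp_all add: center_mult_mult center_mult_ldiv center_mult_rdiv)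
    moreover have "loop_oper Q f [z, w] \<in> Z"
      using zw False by (cases f) (auto simp: center_mult center_ldiv center_rdiv)
    moreover have "loop_oper Q f ys \<in> carrier Q"
      using y ys by (cases f) (auto simp: closed)
    ultimately show ?thesis unfolding center_rel_def by auto
  qed
qed

lemma centralizes_center_rel:
  "centralizes (loop_algebra Q) (center_rel Q) (full_cong (loop_algebra Q))
    (zero_cong (loop_algebra Q))"
  unfolding centralizes_def
proof (intro allI impI; elim conjE)
  fix n t a b us vs
  assume t: "tm_in (arity (loop_algebra Q)) (n + 1) t" and ab: "(a, b) \<in> center_rel Q"
    and len: "length us = n" "length vs = n"
    and uv: "list_all2 (\<lambda>u v. (u, v) \<in> full_cong (loop_algebra Q)) us vs"
    and eq: "(tm_op (loop_algebra Q) t (a # us), tm_op (loop_algebra Q) t (a # vs))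
      \<in> zero_cong (loop_algebra Q)"
  have us: "set us \<subseteq> carrier Q" and vs: "set vs \<subseteq> carrier Q"
    using uv by (induction rule: list_all2_induct) (auto simp: full_cong_def)
  \<comment> \<open>Symmetry makes b the multiple of a, the direction in which the term lemma
    transports an equality from a to b.\<close>
  obtain z where z: "z \<in> Z" "b = z \<otimes> a" "a \<in> carrier Q"
    using symD[OF center_rel_sym ab] by (auto simp: center_rel_def)
  obtain w where w: "\<And>xs. \<lbrakk>set xs \<subseteq> carrier Q; length xs = n\<rbrakk> \<Longrightarrow>
      tm_op (loop_algebra Q) t (b # xs) = w \<otimes> tm_op (loop_algebra Q) t (a # xs)"
    using tm_op_center_mult[OF z(1), of n t] t z by auto
  have "tm_op (loop_algebra Q) t (b # us) = tm_op (loop_algebra Q) t (b # vs)"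
    using eq w us vs len by (auto simp: zero_cong_def)
  moreover have "tm_op (loop_algebra Q) t (b # us) \<in> carrier Q"
    using t z us len by (intro tm_op_closed[of "n + 1"]) (auto simp: center_closed mult_closed)
  ultimately show "(tm_op (loop_algebra Q) t (b # us), tm_op (loop_algebra Q) t (b # vs))
      \<in> zero_cong (loop_algebra Q)"
    by (auto simp: zero_cong_def)
qed

section \<open>Every centralizing congruence lies in \<open>center_rel\<close>\<close>

lemma center_if_centralizes:
  assumes c: "centralizes (loop_algebra Q) \<alpha> (full_cong (loop_algebra Q))
      (zero_cong (loop_algebra Q))"
    and a: "(\<one>, a) \<in> \<alpha>" "a \<in> carrier Q"
  shows "a \<in> Z"
proof (rule centerI)
  define M where "M s t = App Mult [s, t]" for s t
  note * = centralizes_fullD[OF c a(1)]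
  note simps = M_def numeral_2_eq_2 numeral_3_eq_3 mult_closed one_closed mult_one one_mult a(2)
  show "a \<in> carrier Q" by (rule a)
  fix x assume x: "x \<in> carrier Q"
  \<comment> \<open>Padding parameters with 1 makes both sides values of a single term. Here (x1 x0)
    x2 at (1, x) and (x, 1) gives x twice when x0 = 1, but ax and xa when x0 = a. The two
    associativity identities are encoded by (x0 x1) x2 and (x1 (x0 x2)) x3 in the same way.\<close>
  show "a \<otimes> x = x \<otimes> a"
    using *[of "[\<one>, x]" "M (M (Var 1) (Var 0)) (Var 2)" "[x, \<one>]"] x by (simp add: simps)
  fix y assume y: "y \<in> carrier Q"
  show "a \<otimes> (x \<otimes> y) = (a \<otimes> x) \<otimes> y"
    using *[of "[x \<otimes> y, \<one>]" "M (M (Var 0) (Var 1)) (Var 2)" "[x, y]"] x y by (simp add: simps)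
  show "x \<otimes> (a \<otimes> y) = (x \<otimes> a) \<otimes> y"
    using *[of "[x, y, \<one>]" "M (M (Var 1) (M (Var 0) (Var 2))) (Var 3)" "[x, \<one>, y]"] x y
    by (simp add: simps)
qed

text \<open>Right division by b moves an arbitrary pair to the class of 1: b/b = 1 is related to
  a/b, so a/b is central, and a = (a/b)b exhibits the required factor.\<close>

lemma centralizing_congruence_subset:
  assumes \<alpha>: "congruence (loop_algebra Q) \<alpha>"
    and c: "centralizes (loop_algebra Q) \<alpha> (full_cong (loop_algebra Q))
      (zero_cong (loop_algebra Q))"
  shows "\<alpha> \<subseteq> center_rel Q"
proof (rule subrelI)
  fix a b assume ab: "(a, b) \<in> \<alpha>"
  have eq: "equiv (carrier Q) \<alpha>" using \<alpha> by (simp add: congruence_def)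
  then have cl: "a \<in> carrier Q" "b \<in> carrier Q"
    using ab equiv_class_eq_iff by (metis, metis)
  have "(b, a) \<in> \<alpha>" "(b, b) \<in> \<alpha>"
    using eq ab congruence_refl[OF \<alpha>] cl by (auto simp: equiv_def dest: symD)
  then have "(loop_oper Q RDiv [b, b], loop_oper Q RDiv [a, b]) \<in> \<alpha>"
    using \<alpha> unfolding congruence_def loop_algebra_simps
    by (metis list_all2_Cons list_all2_Nil loop_arity.simps(4) length_Cons list.size(3)
        numeral_2_eq_2)
  then have "(b \<oslash> b, a \<oslash> b) \<in> \<alpha>" by simp
  moreover have "b \<oslash> b = \<one>"
    by (rule rdiv_eqI) (simp_all add: cl one_mult one_closed)
  ultimately have "a \<oslash> b \<in> Z"
    using cl by (auto intro!: center_if_centralizes[OF c] simp: rdiv_closed)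
  moreover have "a = (a \<oslash> b) \<otimes> b" using cl by (simp add: rdiv_mult)
  ultimately show "(a, b) \<in> center_rel Q" using cl unfolding center_rel_def by blast
qed

lemma ua_center_eq_center_rel: "ua_center (loop_algebra Q) = center_rel Q"
  by (intro ua_center_eqI congruence_center_rel centralizes_center_rel
      centralizing_congruence_subset)

text \<open>Over b = 1 the central multiples z1 are just the central elements z.\<close>

lemma cong_kernel_center_rel: "cong_kernel Q (center_rel Q) = Z"
  unfolding cong_kernel_def center_rel_def
  by (auto simp: center_closed mult_one one_closed) (metis center_closed mult_one)

end

theorem theorem10p1:
  fixes Q :: "('a, 'm) loop_scheme"
  assumes "loop Q"
  shows "loop_center Q = cong_kernel Q (ua_center (loop_algebra Q))"
  using assms by (simp add: loop.ua_center_eq_center_rel loop.cong_kernel_center_rel)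

end
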